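(* If a convex body $K$ in $\mathbb{R}^2$ has $n$-fold rotational symmetry about $o$, where $n\ge 3$, then $$|K|\cdot|K^*|\ge n^2\sin^2(\pi/n),$$ with equality if and only if $K$ is a regular $n$-gon.
   Context: $o$ is the origin of $\mathbb{R}^2$, $\langle\cdot,\cdot\rangle$ the scalar product, $|\cdot|$ denotes area. A convex body is a compact convex set with non-empty interior. $K$ has $n$-fold rotational symmetry about $o$ if it is invariant under the rotation about $o$ through the angle $2\pi/n$ (this implies $o\in\operatorname{int}K$). The polar is $K^*=\{x\in\mathbb{R}^2:\ \langle x,y\rangle\le 1\ \text{for all } y\in K\}$. *)

theory Defs
  imports "HOL-Analysis.Analysis"
begin

definition convex_body :: "'a::euclidean_space set \<Rightarrow> bool" where
  "convex_body K \<longleftrightarrow> compact K \<and> convex K \<and> interior K \<noteq> {}"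

(* Counterclockwise rotation of the plane about the origin through the angle t. *)
definition rot :: "real \<Rightarrow> real^2 \<Rightarrow> real^2" where
  "rot t x = vector [cos t * x$1 - sin t * x$2, sin t * x$1 + cos t * x$2]"

definition rotational_symmetry :: "nat \<Rightarrow> (real^2) set \<Rightarrow> bool" where
  "rotational_symmetry n K \<longleftrightarrow> rot (2 * pi / real n) ` K = K"

definition polar :: "'a::real_inner set \<Rightarrow> 'a set" where
  "polar K = {x. \<forall>y\<in>K. x \<bullet> y \<le> 1}"

(* The solid polygon whose vertices are n equally spaced points on a circle;
   its center c is arbitrary and need not be the origin. *)
definition regular_polygon :: "nat \<Rightarrow> (real^2) set \<Rightarrow> bool" where
  "regular_polygon n P \<longleftrightarrow> n \<ge> 3 \<and>
     (\<exists>c v. v \<noteq> 0 \<and> P = convex hull ((\<lambda>k. c + rot (2 * pi * real k / real n) v) ` {..<n}))"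

end

theory Submission
  imports Defs
begin

text \<open>Write \<open>a = pi / n\<close>, \<open>c = n * sin a\<close>, and \<open>R\<close> for the rotation through \<open>a\<close>.  Everything rests on one estimate,
  \<open>symmetric_measure_ge\<close>: a convex set \<open>C\<close> with the symmetry satisfies \<open>area C \<ge> c * (q \<bullet> R x)\<close> for all
  \<open>x\<close>, \<open>q\<close> in \<open>C\<close>.  Among the copies of \<open>q\<close> in its orbit, the one between \<open>x\<close> and the next copy of
  \<open>x\<close> makes the right-hand side largest, and for this copy it equals the area of the \<open>2 * n\<close>
  triangles that the alternating copies of \<open>x\<close> and \<open>q\<close> span with the origin.  Put differently, \<open>(c / area C) R\<close> maps \<open>C\<close> into its polar.

  For the inequality, choose a frontier point \<open>x\<close> of \<open>K\<close> and \<open>y\<close> in the polar with \<open>x \<bullet> y = 1\<close>.  Then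
  \<open>(c / area K) R x\<close> lies in the polar, and the estimate for the polar, applied to this point and \<open>y\<close>,
  bounds its area below by \<open>(c\<^sup>2 / area K) * (R x \<bullet> R y) = c\<^sup>2 / area K\<close>.

  If equality holds, then for every such pair the point \<open>q = (c / area (polar K)) R y\<close> lies in \<open>K\<close> by the
  bipolar theorem, and the \<open>2 * n\<close> triangles spanned by the orbits of \<open>x\<close> and \<open>q\<close> already have the full
  area of \<open>K\<close>.  So \<open>K\<close> is the convex hull of these two orbits, for every frontier point \<open>x\<close>
  (\<open>hull_of_two_orbits\<close>).  In particular \<open>K\<close> is a polygon, and choosing \<open>x\<close> on its frontier but not at a
  vertex leaves only the orbit of \<open>q\<close> as vertices: \<open>K\<close> is a regular \<open>n\<close>-gon.

  Conversely, a regular \<open>n\<close>-gon with the symmetry is centred at the origin.  It and its polar are covered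
  by \<open>n\<close> triangles each, which bounds the product of the areas above by \<open>c\<^sup>2\<close>
  (\<open>regular_polygon_volume_product_le\<close>).\<close>

section \<open>Rotations and polar coordinates\<close>

definition dir :: "real \<Rightarrow> real^2" where
  "dir t = vector [cos t, sin t]"

lemma inner_dir: "dir s \<bullet> dir t = cos (s - t)"
  by (simp add: dir_def inner_vec_def sum_2 cos_diff)

lemma norm_dir [simp]: "norm (dir t) = 1"
  by (simp add: norm_eq_sqrt_inner inner_dir)

lemma rot_scaleR_dir: "rot s (r *\<^sub>R dir t) = r *\<^sub>R dir (s + t)"
  by (simp add: vec_eq_iff forall_2 rot_def dir_def cos_add sin_add algebra_simps)

lemma linear_rot: "linear (rot t)"
  by (rule linearI) (simp_all add: vec_eq_iff forall_2 rot_def algebra_simps)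

lemma rot_add: "rot s (rot t x) = rot (s + t) x"
  by (simp add: vec_eq_iff forall_2 rot_def cos_add sin_add algebra_simps)

lemma rot_period: "rot (2 * pi * of_int m + t) x = rot t x"
proof -
  have "cos (2 * pi * of_int m + t) = cos t" "sin (2 * pi * of_int m + t) = sin t"
    using sin_cos_eq_iff[of "2 * pi * of_int m + t" t] by (auto simp: add.commute)
  then show ?thesis by (simp add: rot_def)
qed

lemma rot_0 [simp]: "rot 0 x = x"
  by (simp add: vec_eq_iff forall_2 rot_def)

lemma inner_rot: "rot t x \<bullet> rot t y = x \<bullet> y"
proof -
  have "rot t x \<bullet> rot t y = ((cos t)\<^sup>2 + (sin t)\<^sup>2) * (x \<bullet> y)"
    by (simp only: rot_def inner_vec_def sum_2 vector_2 inner_real_def) algebra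
  then show ?thesis by simp
qed

lemma inner_rot_left: "rot t x \<bullet> y = x \<bullet> rot (- t) y"
  using inner_rot[of "- t" "rot t x" y] by (simp add: rot_add)

lemma norm_rot [simp]: "norm (rot t x) = norm x"
  by (simp add: norm_eq_sqrt_inner inner_rot)

lemma inj_rot: "inj (rot t)"
  by (metis (no_types, lifting) add.left_inverse injI rot_0 rot_add)

text \<open>The window of length \<open>2 * pi\<close> for the angle starts at an arbitrary \<open>\<alpha>\<close>, so that the angle can be
  measured from whichever point plays the role of the first vertex.\<close>

lemma polar_form:
  obtains r t where "0 \<le> r" "\<alpha> \<le> t" "t < \<alpha> + 2 * pi" "x = r *\<^sub>R dir t"
proof (cases "x = 0")
  case True
  with that[of 0 \<alpha>] show thesis by simp
next
  case False
  define z where "z = rot (- \<alpha>) x"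
  have z: "norm z = norm x" by (simp add: z_def)
  then have "(norm x)\<^sup>2 = (z $ 1)\<^sup>2 + (z $ 2)\<^sup>2"
    using power2_norm_eq_inner[of z] by (simp add: inner_vec_def sum_2 power2_eq_square)
  then have "(z $ 1 / norm x)\<^sup>2 + (z $ 2 / norm x)\<^sup>2 = (norm x)\<^sup>2 / (norm x)\<^sup>2"
    by (simp only: power_divide add_divide_distrib)
  with False have "(z $ 1 / norm x)\<^sup>2 + (z $ 2 / norm x)\<^sup>2 = 1"
    by simp
  then obtain t where t: "0 \<le> t" "t < 2*pi" "z $ 1 / norm x = cos t" "z $ 2 / norm x = sin t"
    by (rule sincos_total_2pi)
  then have "z = norm x *\<^sub>R dir t"
    using False by (simp add: vec_eq_iff forall_2 dir_def field_simps)
  then have "rot \<alpha> z = norm x *\<^sub>R dir (\<alpha> + t)"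
    by (simp add: rot_scaleR_dir)
  then have "x = norm x *\<^sub>R dir (\<alpha> + t)"
    by (simp add: z_def rot_add)
  with t that[of "norm x" "\<alpha> + t"] show thesis by simp
qed

lemma polar_angle_unique:
  assumes "r *\<^sub>R dir s = r' *\<^sub>R dir t" "0 < r" "0 < r'"
    and "\<alpha> \<le> s" "s < \<alpha> + 2 * pi" "\<alpha> \<le> t" "t < \<alpha> + 2 * pi"
  shows "s = t"
proof -
  have "norm (r *\<^sub>R dir s) = norm (r' *\<^sub>R dir t)"
    by (simp only: assms(1))
  with assms(2,3) have "r = r'" by simp
  with assms have "dir s = dir t" by simp
  then have "sin s = sin t \<and> cos s = cos t"
    by (simp add: dir_def vec_eq_iff forall_2)
  then obtain m :: int where m: "s = t + 2 * pi * m"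
    using sin_cos_eq_iff by blast
  with assms have "\<bar>2 * pi * of_int m\<bar> < 2 * pi * 1" by linarith
  then have "\<bar>of_int m :: real\<bar> < 1"
    by (simp add: abs_mult)
  with m show ?thesis by simp
qed

section \<open>The area of a fan of triangles\<close>

lemma negligible_line: "negligible (span {dir t})"
  by (rule negligible_lowdim) simp

lemma measure_triangle_dir:
  "measure lebesgue (convex hull {0, r *\<^sub>R dir s, r' *\<^sub>R dir t}) = \<bar>r * r' * sin (t - s)\<bar> / 2"
proof -
  have "r' * cos t * (r * sin s) - r * cos s * (r' * sin t) = - (r * r' * sin (t - s))"
    by (simp add: sin_diff algebra_simps)
  moreover have "closed (convex hull {0, r *\<^sub>R dir s, r' *\<^sub>R dir t})"
    by (intro compact_imp_closed finite_imp_compact_convex_hull) simp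
  ultimately show ?thesis
    by (simp add: measure_completion content_triangle borel_closed) (simp add: dir_def)
qed

lemma convex_hull_origin_triangle:
  "convex hull {0, u, v :: 'a::real_vector}
    = {a *\<^sub>R u + b *\<^sub>R v | a b. 0 \<le> a \<and> 0 \<le> b \<and> a + b \<le> 1}"
proof (intro set_eqI iffI)
  fix x assume "x \<in> {a *\<^sub>R u + b *\<^sub>R v | a b. 0 \<le> a \<and> 0 \<le> b \<and> a + b \<le> 1}"
  then obtain a b where "x = a *\<^sub>R u + b *\<^sub>R v" "0 \<le> a" "0 \<le> b" "a + b \<le> 1"
    by blast
  then have "x = (1 - a - b) *\<^sub>R 0 + a *\<^sub>R u + b *\<^sub>R v" "0 \<le> 1 - a - b"
    "(1 - a - b) + a + b = 1" by auto
  then show "x \<in> convex hull {0, u, v}"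
    unfolding convex_hull_3 using \<open>0 \<le> a\<close> \<open>0 \<le> b\<close> by blast
qed (fastforce simp: convex_hull_3)

text \<open>Consecutive triangles of a fan share an edge.  Splitting off the line through the second edge, a null
  set, leaves each of them inside a half-open sector, and half-open sectors can be disjoint.\<close>

lemma triangle_subset_sector:
  assumes "0 \<le> r" "0 \<le> r'" "s \<le> t" "t < s + pi"
  shows "convex hull {0, r *\<^sub>R dir s, r' *\<^sub>R dir t}
    \<subseteq> {c *\<^sub>R dir \<phi> | c \<phi>. 0 < c \<and> s \<le> \<phi> \<and> \<phi> < t} \<union> span {dir t}"
proof
  fix z assume "z \<in> convex hull {0, r *\<^sub>R dir s, r' *\<^sub>R dir t}"
  then obtain a b where ab: "z = a *\<^sub>R r *\<^sub>R dir s + b *\<^sub>R r' *\<^sub>R dir t" "0 \<le> a" "0 \<le> b"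
    by (auto simp: convex_hull_origin_triangle)
  obtain c \<phi> where c: "0 \<le> c" "s \<le> \<phi>" "\<phi> < s + 2 * pi" "z = c *\<^sub>R dir \<phi>"
    using polar_form .
  show "z \<in> {c *\<^sub>R dir \<phi> | c \<phi>. 0 < c \<and> s \<le> \<phi> \<and> \<phi> < t} \<union> span {dir t}"
  proof (cases "c = 0 \<or> s = t")
    case True
    have "z \<in> span {dir t}"
    proof (cases "c = 0")
      case True
      with c show ?thesis by (simp add: span_zero)
    next
      case False
      with True have "s = t" by simp
      with ab(1) have "z = (a * r + b * r') *\<^sub>R dir t"
        by (simp add: scaleR_left_distrib)
      then show ?thesis by (simp only: span_base span_scale insertI1)
    qed
    then show ?thesis by simp
  next
    case False
    with c assms have pos: "0 < c" "s < t" by auto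
    have sin_pos: "0 < sin (t - s)"
      using pos assms by (intro sin_gt_zero) auto
    \<comment> \<open>Pairing z with the normals of the two edges reads off the signs of the two sines.\<close>
    have "z \<bullet> dir (s + pi/2) = c * sin (\<phi> - s)"
      by (simp add: c(4) inner_dir cos_diff sin_diff cos_add sin_add algebra_simps)
    moreover have "z \<bullet> dir (s + pi/2) = b * r' * sin (t - s)"
      by (simp add: ab(1) inner_dir inner_add_left cos_diff sin_diff cos_add sin_add algebra_simps)
    ultimately have "0 \<le> c * sin (\<phi> - s)"
      using ab assms sin_pos by simp
    then have 1: "0 \<le> sin (\<phi> - s)"
      using pos by (simp add: zero_le_mult_iff)
    have "z \<bullet> dir (t - pi/2) = c * sin (t - \<phi>)"
      by (simp add: c(4) inner_dir cos_diff sin_diff cos_add sin_add algebra_simps)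
    moreover have "z \<bullet> dir (t - pi/2) = a * r * sin (t - s)"
      by (simp add: ab(1) inner_dir inner_add_left cos_diff sin_diff cos_add sin_add algebra_simps)
    ultimately have "0 \<le> c * sin (t - \<phi>)"
      using ab assms sin_pos by simp
    then have 2: "0 \<le> sin (t - \<phi>)"
      using pos by (simp add: zero_le_mult_iff)
    have "\<phi> \<le> s + pi"
      using sin_lt_zero[of "\<phi> - s"] 1 c by linarith
    have "\<phi> \<le> t"
    proof (rule ccontr)
      assume "\<not> \<phi> \<le> t"
      then have "0 < sin (\<phi> - t)"
        using \<open>\<phi> \<le> s + pi\<close> pos by (intro sin_gt_zero) auto
      then show False using 2 sin_minus[of "\<phi> - t"] by simp
    qed
    show ?thesis
    proof (cases "\<phi> = t")
      case True
      with c show ?thesis by (simp add: span_base span_scale)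
    next
      case False
      with \<open>\<phi> \<le> t\<close> have "\<phi> < t" by simp
      with c(2,4) pos(1) show ?thesis by blast
    qed
  qed
qed

text \<open>A convex set that contains the origin and points met in counterclockwise order during at most one
  turn contains the triangles spanned by the origin and consecutive points.  These triangles overlap
  only in lines, because the half-open sectors that carry them are disjoint within one turn.\<close>

lemma sum_fan_le_measure:
  fixes C :: "(real^2) set"
  assumes C: "C \<in> lmeasurable" "convex C" "0 \<in> C"
    and v: "\<And>i. i \<le> m \<Longrightarrow> 0 \<le> \<rho> i \<and> \<rho> i *\<^sub>R dir (\<theta> i) \<in> C"
    and step: "\<And>i. i < m \<Longrightarrow> \<theta> i \<le> \<theta> (Suc i) \<and> \<theta> (Suc i) < \<theta> i + pi"
    and total: "\<theta> m \<le> \<theta> 0 + 2 * pi"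
  shows "(\<Sum>i<m. \<rho> i * \<rho> (Suc i) * sin (\<theta> (Suc i) - \<theta> i) / 2) \<le> measure lebesgue C"
proof -
  define T where "T i = convex hull {0, \<rho> i *\<^sub>R dir (\<theta> i), \<rho> (Suc i) *\<^sub>R dir (\<theta> (Suc i))}" for i
  define S where "S i = {c *\<^sub>R dir \<phi> | c \<phi>. 0 < c \<and> \<theta> i \<le> \<phi> \<and> \<phi> < \<theta> (Suc i)}" for i
  define L where "L i = span {dir (\<theta> (Suc i))}" for i
  have mono: "\<theta> i \<le> \<theta> j" if "i \<le> j" "j \<le> m" for i j
    using that
  proof (induction j rule: dec_induct)
    case (step k)
    then show ?case using assms(5)[of k] by simp
  qed simp
  have TSL: "T i \<subseteq> S i \<union> L i" if "i < m" for i
    unfolding T_def S_def L_def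
    using v[of i] v[of "Suc i"] step[of i] that by (intro triangle_subset_sector) auto
  have disj: "S i \<inter> S j = {}" if "i < j" "j < m" for i j
  proof (rule ccontr)
    assume "S i \<inter> S j \<noteq> {}"
    then obtain z where "z \<in> S i" "z \<in> S j" by blast
    then obtain c \<phi> c' \<phi>' where eq: "c *\<^sub>R dir \<phi> = c' *\<^sub>R dir \<phi>'" and pos: "0 < c" "0 < c'"
      and ang: "\<theta> i \<le> \<phi>" "\<phi> < \<theta> (Suc i)" "\<theta> j \<le> \<phi>'" "\<phi>' < \<theta> (Suc j)"
      by (auto simp: S_def)
    have le: "\<theta> 0 \<le> \<theta> i" "\<theta> (Suc i) \<le> \<theta> j" "\<theta> j \<le> \<theta> m" "\<theta> (Suc j) \<le> \<theta> m" "\<theta> 0 \<le> \<theta> j"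
      using that by (auto intro!: mono)
    have "\<phi> = \<phi>'"
      by (rule polar_angle_unique[OF eq pos, of "\<theta> 0"]) (use le ang total in linarith)+
    with le ang show False by linarith
  qed
  have null: "negligible (T i \<inter> T j)" if "i < m" "j < m" "i \<noteq> j" for i j
  proof -
    have "S i \<inter> S j = {}"
      using disj[of i j] disj[of j i] that by (cases i j rule: linorder_cases) auto
    then have "T i \<inter> T j \<subseteq> L i \<union> L j"
      using TSL[of i] TSL[of j] that by blast
    moreover have "negligible (L i \<union> L j)"
      by (simp add: L_def negligible_line)
    ultimately show ?thesis by (rule negligible_subset[rotated])
  qed
  have Tmeas: "T i \<in> lmeasurable" for i
    by (auto simp: T_def intro!: lmeasurable_compact finite_imp_compact_convex_hull)
  have area: "measure lebesgue (T i) = \<rho> i * \<rho> (Suc i) * sin (\<theta> (Suc i) - \<theta> i) / 2" if "i < m" for i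
  proof -
    have "0 \<le> sin (\<theta> (Suc i) - \<theta> i)"
      using step[OF that] by (intro sin_ge_zero) auto
    then show ?thesis
      using v[of i] v[of "Suc i"] that by (simp add: T_def measure_triangle_dir)
  qed
  have sub: "\<Union>(T ` {..<m}) \<subseteq> C"
  proof (rule UN_least)
    fix i assume "i \<in> {..<m}"
    then show "T i \<subseteq> C"
      unfolding T_def using v[of i] v[of "Suc i"] C by (intro hull_minimal) auto
  qed
  have "(\<Sum>i<m. \<rho> i * \<rho> (Suc i) * sin (\<theta> (Suc i) - \<theta> i) / 2) = (\<Sum>i<m. measure lebesgue (T i))"
    by (rule sum.cong) (simp_all only: area lessThan_iff)
  also have "\<dots> = measure lebesgue (\<Union>(T ` {..<m}))"
    using null Tmeas
    by (intro measure_negligible_finite_Union_image[symmetric]) (auto simp: pairwise_def)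
  also have "\<dots> \<le> measure lebesgue C"
    using sub C Tmeas by (intro measure_mono_fmeasurable) auto
  finally show ?thesis .
qed

section \<open>The area of a convex set with rotational symmetry\<close>

text \<open>Among all translates of \<open>s\<close> by multiples of \<open>2 * pi / n\<close>, an \<open>s\<close> with \<open>\<bar>s\<bar> \<le> pi / n\<close> is a closest one
  to \<open>0\<close> on the circle, hence has the largest cosine.\<close>

lemma cos_add_multiple_le:
  assumes "\<bar>s\<bar> \<le> pi / real n" "0 < n"
  shows "cos (s + 2 * pi * of_int m / real n) \<le> cos s"
proof -
  define k where "k = m mod int n"
  define d where "d = m div int n"
  have k: "0 \<le> k" "k < int n" "m = int n * d + k"
    using assms by (simp_all add: k_def d_def)
  have "2 * pi * of_int m / real n = 2 * pi * of_int k / real n + 2 * pi * of_int d"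
    using assms by (simp add: k(3) field_simps)
  then have eq: "cos (s + 2 * pi * of_int m / real n) = cos (s + 2 * pi * of_int k / real n)"
    using sin_cos_eq_iff[of "s + 2 * pi * of_int m / real n" "s + 2 * pi * of_int k / real n"] by auto
  show ?thesis
  proof (cases "k = 0")
    case True
    then show ?thesis using eq by simp
  next
    case False
    with k have "1 \<le> real_of_int k" "real_of_int k \<le> real n - 1" by linarith+
    then have "2 * (pi / real n) * 1 \<le> 2 * (pi / real n) * of_int k"
      "2 * (pi / real n) * of_int k \<le> 2 * (pi / real n) * (real n - 1)"
      by (intro mult_left_mono; simp)+
    moreover have "2 * (pi / real n) * (real n - 1) = 2 * pi - 2 * (pi / real n)"
      using assms by (simp add: field_simps)
    moreover define t where "t = s + 2 * pi * of_int k / real n"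
    ultimately have t: "\<bar>s\<bar> \<le> t" "t \<le> 2 * pi - \<bar>s\<bar>"
      using assms by auto
    have "cos t \<le> cos \<bar>s\<bar>"
    proof (cases "t \<le> pi")
      case True
      then show ?thesis using t by (intro cos_monotone_0_pi_le) auto
    next
      case False
      then have "cos (2 * pi - t) \<le> cos \<bar>s\<bar>"
        using t by (intro cos_monotone_0_pi_le) auto
      then show ?thesis by simp
    qed
    then show ?thesis using eq by (simp add: t_def)
  qed
qed

lemma rot_multiple_mem:
  assumes "rotational_symmetry n C" "x \<in> C"
  shows "rot (2 * pi * of_int m / real n) x \<in> C"
proof (induction m rule: int_induct[where k = 0])
  case base
  show ?case using assms by simp
next
  case (step1 i)
  then have "rot (2 * pi / real n) (rot (2 * pi * of_int i / real n) x) \<in> C"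
    using assms(1) by (auto simp: rotational_symmetry_def)
  then show ?case by (simp add: rot_add algebra_simps add_divide_distrib)
next
  case (step2 i)
  then obtain y where "y \<in> C" "rot (2 * pi * of_int i / real n) x = rot (2 * pi / real n) y"
    using assms(1) unfolding rotational_symmetry_def by blast
  then have "rot (- (2 * pi / real n)) (rot (2 * pi * of_int i / real n) x) \<in> C"
    by (simp add: rot_add)
  then show ?case by (simp add: rot_add algebra_simps diff_divide_distrib)
qed

lemma sum_lessThan_double:
  "(\<Sum>i<2 * n. f i) = (\<Sum>k<n. f (2 * k) + f (Suc (2 * k)) :: 'a::comm_monoid_add)"
  by (induction n) (simp_all add: add.assoc)

text \<open>This is the key estimate.  In polar coordinates, with \<open>a = pi / n\<close>, \<open>x\<close> at angle \<open>\<theta>\<close> and \<open>q\<close> at angle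
  \<open>\<psi>\<close>, the left-hand side is \<open>n * sin a * norm q * norm x * cos (\<psi> - \<theta> - a)\<close>.  Replacing \<open>q\<close> by one of
  its rotated copies can only increase the cosine if the copy has an angle \<open>\<eta>\<close> between the angles of \<open>x\<close>
  and of the next copy of \<open>x\<close>.
  The \<open>2 * n\<close> copies of \<open>x\<close> and of \<open>q\<close> then alternate around the origin, and by
  \<open>sin (\<eta> - \<theta>) + sin (\<theta> + 2 * a - \<eta>) = 2 * sin a * cos (\<eta> - \<theta> - a)\<close> the increased value is exactly
  the area of the fan that they span.\<close>

lemma symmetric_measure_ge:
  assumes C: "C \<in> lmeasurable" "convex C" "0 \<in> C" and n: "3 \<le> n"
    and sym: "rotational_symmetry n C" and xq: "x \<in> C" "q \<in> C"
  shows "real n * sin (pi / real n) * (q \<bullet> rot (pi / real n) x) \<le> measure lebesgue C"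
proof -
  define a where "a = pi / real n"
  have a: "0 < a" "2 * a < pi" "real n * a = pi"
    using n by (auto simp: a_def field_simps)
  obtain \<rho> \<theta> where x: "0 \<le> \<rho>" "x = \<rho> *\<^sub>R dir \<theta>"
    using polar_form .
  obtain \<sigma> \<psi> where q: "0 \<le> \<sigma>" "q = \<sigma> *\<^sub>R dir \<psi>"
    using polar_form .
  \<comment> \<open>Turning q back by m steps brings its angle to \<open>\<eta>\<close>, within one step after \<open>\<theta>\<close>.\<close>
  define m where "m = \<lfloor>(\<psi> - \<theta>) / (2 * a)\<rfloor>"
  define \<eta> where "\<eta> = \<psi> - 2 * pi * of_int m / real n"
  have \<eta>: "\<theta> \<le> \<eta>" "\<eta> < \<theta> + 2 * a"
  proof -
    have "of_int m \<le> (\<psi> - \<theta>) / (2 * a)" "(\<psi> - \<theta>) / (2 * a) < of_int m + 1"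
      unfolding m_def by linarith+
    then have "of_int m * (2 * a) \<le> \<psi> - \<theta>" "\<psi> - \<theta> < (of_int m + 1) * (2 * a)"
      using a by (simp_all add: pos_le_divide_eq pos_divide_less_eq)
    moreover have "2 * pi * of_int m / real n = of_int m * (2 * a)"
      by (simp add: a_def)
    ultimately show "\<theta> \<le> \<eta>" "\<eta> < \<theta> + 2 * a"
      by (simp_all add: \<eta>_def algebra_simps)
  qed
  \<comment> \<open>Even indices enumerate the copies of x, odd indices the copies of q.\<close>
  define R where "R i = (if even i then \<rho> else \<sigma>)" for i :: nat
  define A where "A i = (if even i then \<theta> else \<eta>) + 2 * a * real (i div 2)" for i :: nat
  have xm: "\<rho> *\<^sub>R dir (\<theta> + 2 * a * real k) \<in> C" for k
    using rot_multiple_mem[OF sym xq(1), of "int k"]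
    by (simp add: x rot_scaleR_dir a_def add.commute)
  have "2 * pi * of_int (int k - m) / real n + \<psi> = \<eta> + 2 * a * real k" for k
    by (simp add: \<eta>_def a_def algebra_simps diff_divide_distrib)
  then have qm: "\<sigma> *\<^sub>R dir (\<eta> + 2 * a * real k) \<in> C" for k
    using rot_multiple_mem[OF sym xq(2), of "int k - m"] by (simp add: q rot_scaleR_dir)
  have step: "A i \<le> A (Suc i) \<and> A (Suc i) < A i + pi" for i
    using \<eta> a by (auto simp: A_def algebra_simps elim!: evenE oddE)
  have "(\<Sum>i<2*n. R i * R (Suc i) * sin (A (Suc i) - A i) / 2) \<le> measure lebesgue C"
  proof (rule sum_fan_le_measure[OF C])
    show "0 \<le> R i \<and> R i *\<^sub>R dir (A i) \<in> C" for i
      using x q xm qm by (auto simp: R_def A_def)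
    show "A (2 * n) \<le> A 0 + 2 * pi"
      using a(3) by (simp add: A_def mult.commute)
  qed (rule step)
  also have "(\<Sum>i<2*n. R i * R (Suc i) * sin (A (Suc i) - A i) / 2)
    = (\<Sum>k<n. \<rho> * \<sigma> * sin (\<eta> - \<theta>) / 2 + \<rho> * \<sigma> * sin (\<theta> + 2 * a - \<eta>) / 2)"
    unfolding sum_lessThan_double
    by (intro sum.cong) (simp_all add: R_def A_def algebra_simps)
  also have "\<dots> = real n * (\<rho> * \<sigma> * ((sin (\<eta> - \<theta>) + sin (\<theta> + 2 * a - \<eta>)) / 2))"
    by (simp add: algebra_simps add_divide_distrib)
  also have "(sin (\<eta> - \<theta>) + sin (\<theta> + 2 * a - \<eta>)) / 2 = sin a * cos (\<eta> - \<theta> - a)"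
  proof -
    have "((\<eta> - \<theta>) - (\<theta> + 2 * a - \<eta>)) / 2 = \<eta> - \<theta> - a"
      "((\<eta> - \<theta>) + (\<theta> + 2 * a - \<eta>)) / 2 = a" by (simp_all add: field_simps)
    then show ?thesis
      by (simp only: sin_plus_sin)
  qed
  finally have 1: "real n * (\<rho> * \<sigma> * (sin a * cos (\<eta> - \<theta> - a))) \<le> measure lebesgue C" .
  have \<psi>: "\<psi> - \<theta> - a = (\<eta> - \<theta> - a) + 2 * pi * of_int m / real n"
    by (simp add: \<eta>_def)
  have "cos (\<psi> - \<theta> - a) \<le> cos (\<eta> - \<theta> - a)"
    unfolding \<psi> using \<eta> n by (intro cos_add_multiple_le) (simp_all add: a_def abs_le_iff)
  moreover have "0 \<le> sin a"
    using a by (intro sin_ge_zero) auto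
  ultimately have "real n * (\<rho> * \<sigma> * (sin a * cos (\<psi> - \<theta> - a)))
    \<le> real n * (\<rho> * \<sigma> * (sin a * cos (\<eta> - \<theta> - a)))"
    using x q by (intro mult_left_mono) auto
  moreover have "q \<bullet> rot a x = \<rho> * \<sigma> * cos (\<psi> - \<theta> - a)"
    by (simp add: x q rot_scaleR_dir inner_dir algebra_simps)
  ultimately show ?thesis
    using 1 by (simp add: a_def algebra_simps)
qed

section \<open>The position of the origin\<close>

lemma inner_rot_self: "x \<bullet> rot t x = cos t * (x \<bullet> x)"
  by (simp add: rot_def inner_vec_def sum_2 algebra_simps)

lemma cos_angle_less_1:
  assumes "3 \<le> n"
  shows "cos (2 * pi / real n) < 1"
proof -
  have "2 * pi / real n \<le> pi"
    using assms by (simp add: field_simps)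
  then show ?thesis
    using assms cos_monotone_0_pi[of 0 "2 * pi / real n"] by simp
qed

lemma rot_fixed_point:
  assumes "3 \<le> n" "rot (2 * pi / real n) x = x"
  shows "x = 0"
proof -
  have "(1 - cos (2 * pi / real n)) * (x \<bullet> x) = 0"
    using inner_rot_self[of x "2 * pi / real n"] assms(2) by (simp add: algebra_simps)
  then show ?thesis
    using cos_angle_less_1[OF assms(1)] by simp
qed

text \<open>The centroid of an orbit is a fixed point of the rotation, and the origin is the only one.\<close>

lemma symmetric_imp_0_mem:
  assumes n: "3 \<le> n" and sym: "rotational_symmetry n C" and C: "convex C" "C \<noteq> {}"
  shows "0 \<in> C"
proof -
  obtain x where x: "x \<in> C" using C by blast
  define f where "f k = rot (2 * pi * real k / real n) x" for k
  have f: "f k \<in> C" for k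
    using rot_multiple_mem[OF sym x, of "int k"] by (simp add: f_def)
  have "f n = f 0"
    using n rot_period[of 1 0 x] by (simp add: f_def)
  then have shift: "(\<Sum>k<n. f (Suc k)) = (\<Sum>k<n. f k)"
    using sum.lessThan_Suc_shift[of f n] sum.lessThan_Suc[of f n] by (simp add: add.commute)
  have "rot (2 * pi / real n) (f k) = f (Suc k)" for k
    by (simp add: f_def rot_add algebra_simps add_divide_distrib)
  then have "rot (2 * pi / real n) (\<Sum>k<n. f k) = (\<Sum>k<n. f (Suc k))"
    by (simp add: linear_sum[OF linear_rot])
  with shift have "(\<Sum>k<n. f k) = 0"
    by (intro rot_fixed_point[OF n]) simp
  moreover have "(\<Sum>k<n. (1 / real n) *\<^sub>R f k) \<in> C"
    using n f by (intro convex_sum C) auto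
  ultimately show ?thesis
    by (simp add: scaleR_sum_right[symmetric])
qed

lemma rotational_symmetry_interior:
  assumes "rotational_symmetry n C"
  shows "rotational_symmetry n (interior C)"
  using assms
  by (simp add: rotational_symmetry_def interior_injective_linear_image[OF linear_rot inj_rot, symmetric])

section \<open>Polar sets\<close>

lemma closed_polar: "closed (polar K)"
proof -
  have "polar K = (\<Inter>y\<in>K. {x. y \<bullet> x \<le> 1})"
    by (auto simp: polar_def inner_commute)
  then show ?thesis
    by (simp add: closed_INT closed_halfspace_le)
qed

lemma convex_polar: "convex (polar K)"
proof -
  have "polar K = (\<Inter>y\<in>K. {x. y \<bullet> x \<le> 1})"
    by (auto simp: polar_def inner_commute)
  then show ?thesis
    by (simp add: convex_INT convex_halfspace_le)
qed

lemma zero_mem_polar: "0 \<in> polar K"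
  by (simp add: polar_def)

lemma bounded_polar:
  fixes K :: "'a::real_inner set"
  assumes "0 \<in> interior K"
  shows "bounded (polar K)"
proof -
  obtain e where e: "0 < e" "cball 0 e \<subseteq> K"
    using assms mem_interior_cball by blast
  have "norm x \<le> 1 / e" if "x \<in> polar K" for x
  proof (cases "x = 0")
    case False
    then have "(e / norm x) *\<^sub>R x \<in> K"
      using e by (auto intro!: subsetD[OF e(2)])
    with that have "x \<bullet> ((e / norm x) *\<^sub>R x) \<le> 1"
      unfolding polar_def by blast
    moreover have "x \<bullet> x = norm x * norm x"
      by (metis power2_norm_eq_inner power2_eq_square)
    ultimately have "e * norm x \<le> 1"
      using False by simp
    then show ?thesis using e by (simp add: field_simps)
  qed (use e in simp)
  then show ?thesis by (auto intro: boundedI)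
qed

lemma compact_polar:
  fixes K :: "'a::euclidean_space set"
  assumes "0 \<in> interior K"
  shows "compact (polar K)"
  using closed_polar bounded_polar[OF assms] by (simp add: compact_eq_bounded_closed)

lemma rotational_symmetry_polar:
  assumes "rotational_symmetry n K"
  shows "rotational_symmetry n (polar K)"
proof -
  define t where "t = 2 * pi / real n"
  have K: "rot t ` K = K"
    using assms by (simp add: rotational_symmetry_def t_def)
  have "rot t x \<in> polar K \<longleftrightarrow> (\<forall>y\<in>rot t ` K. rot t x \<bullet> y \<le> 1)" for x
    by (simp add: polar_def K)
  then have iff: "rot t x \<in> polar K \<longleftrightarrow> x \<in> polar K" for x
    by (simp add: polar_def inner_rot)
  have "rot t ` polar K = polar K"
  proof (intro equalityI subsetI)
    fix z assume "z \<in> polar K"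
    moreover have "z = rot t (rot (- t) z)"
      by (simp add: rot_add)
    ultimately show "z \<in> rot t ` polar K"
      using iff by (metis imageI)
  qed (use iff in blast)
  then show ?thesis
    by (simp add: rotational_symmetry_def t_def)
qed

text \<open>One half of the bipolar theorem: a hyperplane separating \<open>z\<close> from \<open>K\<close> can be scaled to a point of the
  polar set, since it does not pass through the origin.\<close>

lemma bipolar_mem:
  fixes K :: "'a::euclidean_space set"
  assumes K: "closed K" "convex K" "0 \<in> K" and z: "\<And>y. y \<in> polar K \<Longrightarrow> z \<bullet> y \<le> 1"
  shows "z \<in> K"
proof (rule ccontr)
  assume "z \<notin> K"
  then obtain a b where ab: "a \<bullet> z < b" "\<And>x. x \<in> K \<Longrightarrow> a \<bullet> x > b"
    using separating_hyperplane_closed_point[OF K(2,1)] by blast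
  have b: "b < 0" using ab(2)[OF K(3)] by simp
  have "(1 / b) *\<^sub>R a \<in> polar K"
    using ab(2) b by (force simp: polar_def field_simps)
  then have "z \<bullet> ((1 / b) *\<^sub>R a) \<le> 1" by (rule z)
  then show False
    using ab(1) b by (simp add: inner_commute field_simps)
qed

text \<open>A supporting hyperplane at \<open>x\<close> misses the interior point \<open>0\<close>; \<open>y\<close> is its normal vector, scaled.\<close>

lemma frontier_dual_point:
  fixes K :: "'a::euclidean_space set"
  assumes K: "closed K" "convex K" "0 \<in> interior K" and x: "x \<in> frontier K"
  obtains y where "y \<in> polar K" "x \<bullet> y = 1"
proof -
  have rel: "rel_interior K = interior K"
    using K(3) by (intro rel_interior_nonempty_interior) auto
  have "x \<in> K" "x \<notin> rel_interior K"
    using x K rel by (auto simp: frontier_def)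
  then obtain a where a: "\<And>y. y \<in> K \<Longrightarrow> a \<bullet> x \<le> a \<bullet> y" "\<And>y. y \<in> rel_interior K \<Longrightarrow> a \<bullet> x < a \<bullet> y"
    using supporting_hyperplane_rel_boundary[OF K(2)] by metis
  have neg: "a \<bullet> x < 0"
    using a(2)[of 0] K rel by simp
  have "(1 / (a \<bullet> x)) *\<^sub>R a \<in> polar K"
    using a(1) neg by (auto simp: polar_def divide_le_eq)
  moreover have "x \<bullet> ((1 / (a \<bullet> x)) *\<^sub>R a) = 1"
    using neg by (simp add: inner_commute)
  ultimately show thesis by (rule that)
qed

section \<open>Frontier and measure of convex bodies\<close>

text \<open>The plane stays connected after removal of finitely many points, so a finite frontier could not
  separate the interior from the unbounded exterior.\<close>

lemma infinite_frontier:
  fixes K :: "(real^2) set"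
  assumes "bounded K" "interior K \<noteq> {}"
  shows "infinite (frontier K)"
proof
  assume fin: "finite (frontier K)"
  have "connected (- frontier K)"
    using fin by (intro path_connected_imp_connected path_connected_complement_countable)
      (auto intro: countable_finite)
  moreover have "- frontier K \<inter> K \<noteq> {}"
    using assms(2) interior_subset by (fastforce simp: frontier_def)
  moreover have "- frontier K - K \<noteq> {}"
  proof
    assume "- frontier K - K = {}"
    then have "UNIV \<subseteq> K \<union> frontier K" by blast
    moreover have "bounded (K \<union> frontier K)"
      using assms(1) by (simp add: bounded_closure frontier_def bounded_diff)
    ultimately show False
      using not_bounded_UNIV bounded_subset by blast
  qed
  ultimately have "- frontier K \<inter> frontier K \<noteq> {}"
    by (rule connected_Int_frontier)
  then show False by simp
qed

text \<open>The open set \<open>interior K - P\<close> has measure zero, hence is empty, and \<open>K\<close> is the closure of its interior.\<close>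

lemma convex_body_eq_if_measure_le:
  assumes K: "convex_body K" and P: "compact P" "P \<subseteq> K"
    and le: "measure lebesgue K \<le> measure lebesgue P"
  shows "P = K"
proof -
  have m: "K \<in> lmeasurable" "P \<in> lmeasurable"
    using K P by (auto simp: convex_body_def intro: lmeasurable_compact)
  have "measure lebesgue (K - P) = measure lebesgue K - measure lebesgue P"
    using m P by (intro measurable_measure_Diff) auto
  also have "\<dots> \<le> 0" using le by simp
  finally have "negligible (K - P)"
    using m by (simp add: negligible_iff_measure measure_le_0_iff fmeasurable.Diff)
  then have "negligible (interior K - P)"
    by (rule negligible_subset) (use interior_subset in blast)
  moreover have "open (interior K - P)"
    using P by (simp add: compact_imp_closed open_Diff)
  ultimately have "interior K \<subseteq> P"
    using open_not_negligible by blast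
  then have "closure (interior K) \<subseteq> P"
    using P by (simp add: closure_minimal compact_imp_closed)
  moreover have "closure (interior K) = K"
    using K by (simp add: convex_body_def convex_closure_interior compact_imp_closed)
  ultimately show ?thesis using P by blast
qed

section \<open>Orbits\<close>

definition orbit :: "nat \<Rightarrow> real^2 \<Rightarrow> (real^2) set" where
  "orbit n x = (\<lambda>k. rot (2 * pi * real k / real n) x) ` {..<n}"

lemma finite_orbit: "finite (orbit n x)"
  by (simp add: orbit_def)

lemma mem_orbit_self: "0 < n \<Longrightarrow> x \<in> orbit n x"
  unfolding orbit_def by (rule image_eqI[of _ _ 0]) auto

lemma orbit_subset:
  assumes "rotational_symmetry n C" "x \<in> C"
  shows "orbit n x \<subseteq> C"
proof
  fix z assume "z \<in> orbit n x"
  then obtain k :: nat where "z = rot (2 * pi * of_int (int k) / real n) x"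
    by (auto simp: orbit_def)
  then show "z \<in> C" by (simp only: rot_multiple_mem[OF assms])
qed

lemma rotational_symmetry_orbit:
  assumes "0 < n"
  shows "rotational_symmetry n (orbit n x)"
  unfolding rotational_symmetry_def
proof (rule endo_inj_surj[OF finite_orbit])
  show "rot (2 * pi / real n) ` orbit n x \<subseteq> orbit n x"
  proof
    fix z assume "z \<in> rot (2 * pi / real n) ` orbit n x"
    then obtain k where k: "k < n" "z = rot (2 * pi / real n) (rot (2 * pi * real k / real n) x)"
      by (auto simp: orbit_def)
    then have z: "z = rot (2 * pi * real (Suc k) / real n) x"
      by (simp add: rot_add algebra_simps add_divide_distrib)
    show "z \<in> orbit n x"
    proof (cases "Suc k = n")
      case True
      then have "z = x" using z rot_period[of 1 0 x] assms by (auto simp del: of_nat_Suc)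
      then show ?thesis using assms by (simp add: mem_orbit_self)
    next
      case False
      with k(1) have "Suc k \<in> {..<n}" by simp
      with z show ?thesis unfolding orbit_def by blast
    qed
  qed
  show "inj_on (rot (2 * pi / real n)) (orbit n x)"
    using inj_rot by (rule inj_on_subset) simp
qed

lemma rotational_symmetry_Un:
  "rotational_symmetry n A \<Longrightarrow> rotational_symmetry n B \<Longrightarrow> rotational_symmetry n (A \<union> B)"
  by (simp add: rotational_symmetry_def image_Un)

lemma rotational_symmetry_convex_hull:
  "rotational_symmetry n A \<Longrightarrow> rotational_symmetry n (convex hull A)"
  by (simp add: rotational_symmetry_def convex_hull_linear_image[OF linear_rot])

lemma extreme_point_rot_multiple:
  assumes sym: "rotational_symmetry n K"
    and e: "rot (2 * pi * real k / real n) x extreme_point_of K"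
  shows "x extreme_point_of K"
proof -
  define t where "t = 2 * pi * real k / real n"
  have "rot t ` K = K"
  proof
    show "rot t ` K \<subseteq> K"
      using rot_multiple_mem[OF sym, of _ "int k"] by (auto simp: t_def)
    show "K \<subseteq> rot t ` K"
    proof
      fix z assume "z \<in> K"
      then have "rot (- t) z \<in> K"
        using rot_multiple_mem[OF sym, of z "- int k"] by (simp add: t_def)
      moreover have "z = rot t (rot (- t) z)" by (simp add: rot_add)
      ultimately show "z \<in> rot t ` K" by blast
    qed
  qed
  then have "rot t ` {x} face_of rot t ` K"
    using e by (simp add: face_of_singleton t_def)
  then have "{x} face_of K"
    by (simp only: face_of_linear_image[OF linear_rot inj_rot])
  then show ?thesis by (simp add: face_of_singleton)
qed

lemma measure_pos_if_interior:
  assumes "compact K" "interior K \<noteq> {}"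
  shows "0 < measure lebesgue (K :: 'a::euclidean_space set)"
proof (rule ccontr)
  assume "\<not> 0 < measure lebesgue K"
  then have "negligible K"
    using assms(1) measure_nonneg[of lebesgue K]
    by (simp add: negligible_iff_measure lmeasurable_compact)
  then have "negligible (interior K)"
    using interior_subset by (rule negligible_subset)
  then show False
    using open_not_negligible assms(2) by blast
qed

lemma convex_body_0_interior:
  assumes "convex_body K" "3 \<le> n" "rotational_symmetry n K"
  shows "0 \<in> interior K"
  using assms
  by (intro symmetric_imp_0_mem[of n] rotational_symmetry_interior) (auto simp: convex_body_def)

section \<open>The inequality\<close>

text \<open>The key estimate, read as membership in the polar set: a rotation through \<open>pi / n\<close> followed by scaling
  maps \<open>C\<close> into its polar.\<close>

lemma scaled_rot_mem_polar:
  assumes "C \<in> lmeasurable" "convex C" "0 \<in> C" "3 \<le> n" "rotational_symmetry n C" "x \<in> C"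
    and pos: "0 < measure lebesgue C"
  shows "(real n * sin (pi / real n) / measure lebesgue C) *\<^sub>R rot (pi / real n) x \<in> polar C"
  unfolding polar_def
proof (intro CollectI ballI)
  fix q assume "q \<in> C"
  with symmetric_measure_ge[OF assms(1-6)]
  have "real n * sin (pi / real n) * (q \<bullet> rot (pi / real n) x) \<le> measure lebesgue C" .
  then show "((real n * sin (pi / real n) / measure lebesgue C) *\<^sub>R rot (pi / real n) x) \<bullet> q \<le> 1"
    using pos by (simp add: inner_commute[of q])
qed

text \<open>Let \<open>c = n * sin (pi / n)\<close> and let \<open>R\<close> be the rotation through \<open>pi / n\<close>.  For dual points \<open>x\<close>, \<open>y\<close> with
  \<open>x \<bullet> y = 1\<close>, the point \<open>p = (c / area K) R x\<close> of the polar and the point \<open>y\<close> enter the key estimate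
  for the polar, whose area is therefore at least \<open>c * (p \<bullet> R y) = c\<^sup>2 / area K\<close>.\<close>

lemma volume_product_ge:
  assumes K: "convex_body K" "3 \<le> n" "rotational_symmetry n K"
  shows "(real n)\<^sup>2 * (sin (pi / real n))\<^sup>2 \<le> measure lebesgue K * measure lebesgue (polar K)"
proof -
  define c where "c = real n * sin (pi / real n)"
  have zero: "0 \<in> interior K"
    using convex_body_0_interior[OF K] .
  have Kc: "compact K" "convex K" "K \<in> lmeasurable" "0 \<in> K"
    using K zero interior_subset by (auto simp: convex_body_def lmeasurable_compact)
  have pos: "0 < measure lebesgue K"
    using Kc zero by (intro measure_pos_if_interior) auto
  have "frontier K \<noteq> {}"
    using infinite_frontier[of K] Kc(1) zero by (metis compact_imp_bounded empty_iff finite.emptyI)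
  then obtain x where x: "x \<in> frontier K" by blast
  then have "x \<in> K"
    using Kc by (auto simp: frontier_def compact_imp_closed)
  obtain y where y: "y \<in> polar K" "x \<bullet> y = 1"
    using frontier_dual_point[OF _ Kc(2) zero x] Kc(1) by (auto simp: compact_imp_closed)
  define p where "p = (c / measure lebesgue K) *\<^sub>R rot (pi / real n) x"
  have "p \<in> polar K"
    unfolding p_def c_def by (rule scaled_rot_mem_polar[OF Kc(3,2,4) K(2,3) \<open>x \<in> K\<close> pos])
  then have "c * (p \<bullet> rot (pi / real n) y) \<le> measure lebesgue (polar K)"
    unfolding c_def
    using symmetric_measure_ge[OF lmeasurable_compact[OF compact_polar[OF zero]] convex_polar
        zero_mem_polar K(2) rotational_symmetry_polar[OF K(3)] y(1)] by blast
  then have "c * c \<le> measure lebesgue K * measure lebesgue (polar K)"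
    using pos y by (simp add: p_def inner_rot field_simps)
  then show ?thesis
    by (simp add: c_def power2_eq_square mult_ac)
qed

section \<open>The equality case\<close>

text \<open>Take \<open>y\<close> dual to \<open>x\<close>.  The point \<open>q\<close> obtained from \<open>y\<close> by a rotation through \<open>pi / n\<close> and scaling lies
  in the bipolar, that is, in \<open>K\<close>.  In the equality case the lower bound that the key estimate gives for
  the pair \<open>x\<close>, \<open>q\<close> equals the area of \<open>K\<close>.  The same bound applies to the smaller body spanned by the
  two orbits, which therefore fills \<open>K\<close>.\<close>

lemma hull_of_two_orbits:
  assumes K: "convex_body K" "3 \<le> n" "rotational_symmetry n K"
    and eq: "measure lebesgue K * measure lebesgue (polar K) = (real n)\<^sup>2 * (sin (pi / real n))\<^sup>2"
    and x: "x \<in> frontier K"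
  obtains q where "q \<noteq> 0" "K = convex hull (orbit n x \<union> orbit n q)"
proof -
  define a where "a = pi / real n"
  define c where "c = real n * sin a"
  define B where "B = measure lebesgue (polar K)"
  have zero: "0 \<in> interior K"
    using convex_body_0_interior[OF K] .
  have Kc: "compact K" "convex K" "K \<in> lmeasurable" "0 \<in> K"
    using K zero interior_subset by (auto simp: convex_body_def lmeasurable_compact)
  have "0 < sin a"
    using K(2) unfolding a_def by (intro sin_gt_zero) (auto simp: field_simps)
  then have c: "0 < c"
    using K(2) by (simp add: c_def)
  have KB: "measure lebesgue K * B = c * c"
    using eq by (simp add: B_def c_def a_def power2_eq_square mult_ac)
  have B: "0 < B"
  proof -
    have "0 \<le> B" by (simp add: B_def)
    moreover have "B \<noteq> 0" using KB c by auto
    ultimately show ?thesis by simp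
  qed
  have "x \<in> K"
    using x Kc by (auto simp: frontier_def compact_imp_closed)
  obtain y where y: "y \<in> polar K" "x \<bullet> y = 1"
    using frontier_dual_point[OF _ Kc(2) zero x] Kc(1) by (auto simp: compact_imp_closed)
  define q where "q = (c / B) *\<^sub>R rot a y"
  have "q \<in> polar (polar K)"
    unfolding q_def c_def B_def a_def
    by (rule scaled_rot_mem_polar[OF lmeasurable_compact[OF compact_polar[OF zero]] convex_polar
        zero_mem_polar K(2) rotational_symmetry_polar[OF K(3)] y(1) B[unfolded B_def]])
  then have "\<And>w. w \<in> polar K \<Longrightarrow> q \<bullet> w \<le> 1"
    unfolding polar_def[of "polar K"] by blast
  then have "q \<in> K"
    by (rule bipolar_mem[OF compact_imp_closed[OF Kc(1)] Kc(2,4)])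
  have "y \<noteq> 0" using y(2) by auto
  moreover have "norm q = c / B * norm y"
    using c B by (simp add: q_def)
  ultimately have "norm q \<noteq> 0" using c B by simp
  then have "q \<noteq> 0" by simp
  define P where "P = convex hull (orbit n x \<union> orbit n q)"
  have symP: "rotational_symmetry n P"
    unfolding P_def using K(2)
    by (intro rotational_symmetry_convex_hull rotational_symmetry_Un rotational_symmetry_orbit) auto
  have Pc: "compact P" "convex P"
    by (auto simp: P_def finite_orbit finite_imp_compact_convex_hull)
  have xqP: "x \<in> P" "q \<in> P"
    using K(2) by (auto simp: P_def intro!: hull_inc mem_orbit_self)
  have "P \<subseteq> K"
    unfolding P_def using Kc(2) orbit_subset[OF K(3)] \<open>x \<in> K\<close> \<open>q \<in> K\<close>
    by (intro hull_minimal) auto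
  have "c * (q \<bullet> rot a x) \<le> measure lebesgue P"
    unfolding c_def a_def
    using symmetric_measure_ge[OF lmeasurable_compact[OF Pc(1)] Pc(2)
        symmetric_imp_0_mem[OF K(2) symP Pc(2)] K(2) symP xqP] xqP by blast
  moreover have "q \<bullet> rot a x = c / B"
    using y by (simp add: q_def inner_rot inner_commute)
  moreover have "c * (c / B) = measure lebesgue K"
    using KB B by (simp add: field_simps)
  ultimately have "P = K"
    using K(1) Pc(1) \<open>P \<subseteq> K\<close> by (intro convex_body_eq_if_measure_le) simp_all
  with \<open>q \<noteq> 0\<close> show thesis
    using that by (simp add: P_def)
qed

text \<open>By the previous lemma \<open>K\<close> is a polygon, so some frontier point \<open>x\<close> is not a vertex.  For this \<open>x\<close> the lemma
  presents \<open>K\<close> as the hull of the orbits of \<open>x\<close> and \<open>q\<close>.  By symmetry no point of the orbit of \<open>x\<close> is a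
  vertex, so all vertices lie in the orbit of \<open>q\<close>.\<close>

lemma equality_imp_regular_polygon:
  assumes K: "convex_body K" "3 \<le> n" "rotational_symmetry n K"
    and eq: "measure lebesgue K * measure lebesgue (polar K) = (real n)\<^sup>2 * (sin (pi / real n))\<^sup>2"
  shows "regular_polygon n K"
proof -
  have Kc: "compact K" "convex K" "interior K \<noteq> {}"
    using K by (auto simp: convex_body_def)
  have inf: "infinite (frontier K)"
    using Kc by (intro infinite_frontier compact_imp_bounded)
  have "frontier K \<noteq> {}"
    using inf by (rule infinite_imp_nonempty)
  then obtain x' where x': "x' \<in> frontier K" by blast
  obtain q' where q': "K = convex hull (orbit n x' \<union> orbit n q')"
    using hull_of_two_orbits[OF K eq x'] .
  define F where "F = orbit n x' \<union> orbit n q'"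
  have F: "finite F" "K = convex hull F"
    unfolding F_def by (simp add: finite_orbit) (rule q')
  obtain x where x: "x \<in> frontier K" "x \<notin> F"
    using inf F(1) by (meson finite_subset subsetI)
  then have not_extreme: "\<not> x extreme_point_of K"
    using extreme_point_of_convex_hull[of x F] F(2) by metis
  obtain q where q: "q \<noteq> 0" "K = convex hull (orbit n x \<union> orbit n q)"
    using hull_of_two_orbits[OF K eq x(1)] .
  have "{e. e extreme_point_of K} \<subseteq> orbit n q"
  proof
    fix e assume "e \<in> {e. e extreme_point_of K}"
    then have e: "e extreme_point_of K" by simp
    then have "e \<in> orbit n x \<union> orbit n q"
      using extreme_point_of_convex_hull[of e "orbit n x \<union> orbit n q"] by (simp only: q(2)[symmetric])
    moreover have "e \<notin> orbit n x"
      using extreme_point_rot_multiple[OF K(3)] e not_extreme by (auto simp: orbit_def)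
    ultimately show "e \<in> orbit n q" by simp
  qed
  then have "K \<subseteq> convex hull (orbit n q)"
    using Krein_Milman_Minkowski[OF Kc(1,2)] hull_mono by metis
  moreover have "convex hull (orbit n q) \<subseteq> K"
    using q(2) by (simp add: hull_mono)
  ultimately have "K = convex hull (orbit n q)" by blast
  then have "K = convex hull ((\<lambda>k. 0 + rot (2 * pi * real k / real n) q) ` {..<n})"
    by (simp add: orbit_def)
  with q(1) K(2) show ?thesis
    unfolding regular_polygon_def by blast
qed

section \<open>The volume product of a regular polygon\<close>

text \<open>A regular polygon with the symmetry about the origin is centred there: it is also symmetric about its
  centre \<open>c\<close>, so the rotation of \<open>c\<close> differs from \<open>c\<close> by a translation that preserves the polygon, and
  only the zero translation preserves a nonempty compact set.\<close>

lemma regular_polygon_centred: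
  assumes n: "3 \<le> n" and K: "regular_polygon n K" and sym: "rotational_symmetry n K"
  obtains v where "v \<noteq> 0" "K = convex hull (orbit n v)"
proof -
  obtain c v where v: "v \<noteq> 0"
    and Kcv: "K = convex hull ((\<lambda>k. c + rot (2 * pi * real k / real n) v) ` {..<n})"
    using K unfolding regular_polygon_def by blast
  define P where "P = convex hull (orbit n v)"
  have K_eq: "K = (+) c ` P"
    unfolding Kcv P_def orbit_def convex_hull_translation[symmetric] image_image ..
  define d where "d = rot (2 * pi / real n) c - c"
  have symP: "rotational_symmetry n P"
    unfolding P_def using n
    by (intro rotational_symmetry_convex_hull rotational_symmetry_orbit) auto
  have shift: "z + d \<in> K" if z: "z \<in> K" for z
  proof -
    obtain p where p: "p \<in> P" "z = c + p" using z K_eq by blast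
    obtain p' where p': "p' \<in> P" "p = rot (2 * pi / real n) p'"
      using p(1) symP unfolding rotational_symmetry_def by blast
    have "c + p' \<in> K" using p'(1) K_eq by blast
    then have "rot (2 * pi / real n) (c + p') \<in> K"
      using sym unfolding rotational_symmetry_def by blast
    then show ?thesis
      by (simp add: linear_add[OF linear_rot] p(2) p'(2) d_def add_ac)
  qed
  have compact: "compact K"
    unfolding Kcv by (intro finite_imp_compact_convex_hull) simp
  have nonempty: "K \<noteq> {}" using n by (auto simp: Kcv lessThan_empty_iff)
  have cont: "continuous_on K (\<lambda>w. d \<bullet> w)" by (intro continuous_intros)
  \<comment> \<open>At a point of K farthest in direction d, a further step by d is possible only if d vanishes.\<close>
  obtain z where z: "z \<in> K" "\<forall>w\<in>K. d \<bullet> w \<le> d \<bullet> z"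
    using continuous_attains_sup[OF compact nonempty cont] by blast
  have "d \<bullet> (z + d) \<le> d \<bullet> z"
    using z(2) shift[OF z(1)] by blast
  then have "d \<bullet> d \<le> 0" by (simp add: inner_add_right)
  then have "d = 0"
    by (metis inner_ge_zero inner_eq_zero_iff antisym)
  then have "c = 0"
    by (intro rot_fixed_point[OF n]) (simp add: d_def)
  then show thesis
    using that[OF v] by (simp add: K_eq P_def)
qed

text \<open>The coordinates of a direction with respect to the two edges of a sector of opening \<open>2 * a\<close>, measured
  from the bisector at angle \<open>\<alpha>\<close>.\<close>

lemma dir_decompose:
  "sin (2 * a) *\<^sub>R dir (\<alpha> + s) = sin (a + s) *\<^sub>R dir (\<alpha> + a) + sin (a - s) *\<^sub>R dir (\<alpha> - a)"
  unfolding sin_double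
  by (simp add: vec_eq_iff forall_2 dir_def sin_add sin_diff cos_add cos_diff algebra_simps)

text \<open>The half-planes \<open>z \<bullet> u\<^sub>k \<le> 1\<close> for the rotated copies \<open>u\<^sub>k\<close> of \<open>u\<close> cut out a regular polygon of inradius
  \<open>1 / norm u\<close>; the right-hand side is its area, the total area of the triangles that join its edges to the
  origin.\<close>

lemma measure_le_circumscribed:
  fixes Z :: "(real^2) set"
  assumes n: "3 \<le> n" and u: "u \<noteq> 0" and Z: "Z \<in> sets lebesgue"
    and half: "\<And>z k. z \<in> Z \<Longrightarrow> k < n \<Longrightarrow> z \<bullet> rot (2 * pi * real k / real n) u \<le> 1"
  shows "measure lebesgue Z \<le> real n * tan (pi / real n) / (norm u)\<^sup>2"
proof -
  define a where "a = pi / real n"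
  have a: "0 < a" "2 * a < pi" "real n * a = pi"
    using n by (auto simp: a_def field_simps)
  have sin_a: "0 < sin a" and cos_a: "0 < cos a"
    using a by (auto intro!: sin_gt_zero cos_gt_zero)
  obtain r \<theta> where r: "0 \<le> r" "u = r *\<^sub>R dir \<theta>"
    using polar_form .
  have rpos: "0 < r" using r u by (cases "r = 0") auto
  \<comment> \<open>The circumradius of the polygon.\<close>
  define w where "w = 1 / (r * cos a)"
  have w: "0 < w" using rpos cos_a by (simp add: w_def)
  define \<alpha> where "\<alpha> k = \<theta> + 2 * a * real k" for k
  define T where "T k = convex hull {0, w *\<^sub>R dir (\<alpha> k - a), w *\<^sub>R dir (\<alpha> k + a)}" for k
  have area: "measure lebesgue (T k) = tan a / r\<^sup>2" for k
  proof -
    have "measure lebesgue (T k) = \<bar>w * w * sin (2 * a)\<bar> / 2"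
      by (simp add: T_def measure_triangle_dir)
    also have "\<dots> = tan a / r\<^sup>2"
      using w sin_a cos_a rpos
      by (simp add: abs_mult sin_double w_def tan_def power2_eq_square)
    finally show ?thesis .
  qed
  have Tmeas: "T k \<in> lmeasurable" for k
    by (auto simp: T_def intro!: lmeasurable_compact finite_imp_compact_convex_hull)
  have "Z \<subseteq> (\<Union>k<n. T k)"
  proof
    fix z assume z: "z \<in> Z"
    obtain \<rho> \<phi> where \<rho>: "0 \<le> \<rho>" "\<theta> - a \<le> \<phi>" "\<phi> < \<theta> - a + 2 * pi" "z = \<rho> *\<^sub>R dir \<phi>"
      using polar_form .
    \<comment> \<open>The sector around the direction of the copy of u with index k contains z, at angle s from it.\<close>
    define k where "k = nat \<lfloor>(\<phi> - \<theta> + a) / (2 * a)\<rfloor>"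
    define s where "s = \<phi> - \<alpha> k"
    have nonneg: "0 \<le> (\<phi> - \<theta> + a) / (2 * a)" using \<rho> a by simp
    then have "real k \<le> (\<phi> - \<theta> + a) / (2 * a)" "(\<phi> - \<theta> + a) / (2 * a) < real k + 1"
      unfolding k_def by linarith+
    then have kb: "real k * (2 * a) \<le> \<phi> - \<theta> + a" "\<phi> - \<theta> + a < (real k + 1) * (2 * a)"
      using a by (simp_all add: pos_le_divide_eq pos_divide_less_eq)
    have "real k * (2 * a) < 2 * pi"
      using kb \<rho>(3) by linarith
    also have "2 * pi = real n * (2 * a)"
      by (simp add: a(3)[symmetric])
    finally have "k < n" using a(1) by simp
    have s: "- a \<le> s" "s \<le> a"
      using kb by (simp_all add: s_def \<alpha>_def algebra_simps)
    have "z \<bullet> rot (2 * a * real k) u \<le> 1"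
      using half[OF z \<open>k < n\<close>] by (simp add: a_def)
    moreover have "z \<bullet> rot (2 * a * real k) u = \<rho> * r * cos s"
      by (simp add: \<rho>(4) r(2) rot_scaleR_dir inner_dir s_def \<alpha>_def algebra_simps)
    ultimately have le1: "\<rho> * r * cos s \<le> 1" by simp
    define p where "p = \<rho> * sin (a - s) / (sin (2 * a) * w)"
    define p' where "p' = \<rho> * sin (a + s) / (sin (2 * a) * w)"
    have sin2a: "0 < sin (2 * a)"
      using a by (intro sin_gt_zero) auto
    have "0 \<le> sin (a - s)" "0 \<le> sin (a + s)"
      using s a by (auto intro!: sin_ge_zero)
    then have pos: "0 \<le> p" "0 \<le> p'"
      using \<rho>(1) sin2a w by (simp_all add: p_def p'_def)
    have "p + p' = \<rho> * (sin (a - s) + sin (a + s)) / (sin (2 * a) * w)"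
      by (simp add: p_def p'_def algebra_simps add_divide_distrib)
    also have "sin (a - s) + sin (a + s) = 2 * sin a * cos s"
      by (simp add: sin_add sin_diff)
    also have "\<rho> * (2 * sin a * cos s) / (sin (2 * a) * w) = \<rho> * r * cos s"
      using sin_a cos_a rpos unfolding sin_double by (simp add: w_def field_simps)
    finally have sum: "p + p' \<le> 1" using le1 by simp
    have "z = (\<rho> / sin (2 * a)) *\<^sub>R (sin (2 * a) *\<^sub>R dir (\<alpha> k + s))"
      using sin2a by (simp add: \<rho>(4) s_def)
    also have "\<dots> = p *\<^sub>R w *\<^sub>R dir (\<alpha> k - a) + p' *\<^sub>R w *\<^sub>R dir (\<alpha> k + a)"
      using w by (simp add: dir_decompose p_def p'_def scaleR_add_right)
    finally have "z \<in> T k"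
      unfolding T_def convex_hull_origin_triangle using pos sum by blast
    then show "z \<in> (\<Union>k<n. T k)" using \<open>k < n\<close> by blast
  qed
  then have "measure lebesgue Z \<le> measure lebesgue (\<Union>k<n. T k)"
    using Z Tmeas by (intro measure_mono_fmeasurable fmeasurable.finite_UN) auto
  also have "\<dots> \<le> (\<Sum>k<n. measure lebesgue (T k))"
    using Tmeas by (intro measure_UNION_le) auto
  also have "\<dots> = real n * tan a / r\<^sup>2"
    by (simp add: area)
  finally show ?thesis
    using rpos by (simp add: a_def r(2))
qed

text \<open>Both \<open>K\<close> and its polar lie in circumscribed regular polygons: the half-planes for the polar have the
  vertices of \<open>K\<close> as normals, and those for \<open>K\<close> have normals in the directions of the edge midpoints.
  The two areas multiply to \<open>n\<^sup>2 * (sin (pi / n))\<^sup>2\<close>.\<close>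

lemma regular_polygon_volume_product_le:
  assumes n: "3 \<le> n" and v: "v \<noteq> 0" and K: "K = convex hull (orbit n v)"
  shows "measure lebesgue K * measure lebesgue (polar K) \<le> (real n)\<^sup>2 * (sin (pi / real n))\<^sup>2"
proof -
  define a where "a = pi / real n"
  have "0 < a" "2 * a < pi"
    using n by (auto simp: a_def field_simps)
  then have sin_a: "0 < sin a" and cos_a: "0 < cos a"
    by (auto intro!: sin_gt_zero cos_gt_zero)
  \<comment> \<open>The vertex of the polar that belongs to the edge from v to its next copy.\<close>
  define u where "u = (1 / ((norm v)\<^sup>2 * cos a)) *\<^sub>R rot a v"
  have nu: "norm u = 1 / (norm v * cos a)"
    using v cos_a by (simp add: u_def power2_eq_square)
  have vertex: "z \<bullet> rot (2 * pi * real k / real n) u \<le> 1" if zo: "z \<in> orbit n v" for z k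
  proof -
    obtain j where z: "z = rot (2 * pi * real j / real n) v"
      using zo by (auto simp: orbit_def)
    have "z \<bullet> rot (2 * pi * real k / real n) (rot a v)
      = v \<bullet> rot (a + 2 * pi * of_int (int k - int j) / real n) v"
      by (simp add: z inner_rot_left rot_add algebra_simps diff_divide_distrib)
    also have "\<dots> = cos (a + 2 * pi * of_int (int k - int j) / real n) * (norm v)\<^sup>2"
      by (simp add: inner_rot_self power2_norm_eq_inner)
    also have "\<dots> \<le> cos a * (norm v)\<^sup>2"
      using n cos_add_multiple_le[of a n "int k - int j"] by (intro mult_right_mono) (auto simp: a_def)
    finally show ?thesis
      using v cos_a by (simp add: u_def linear_cmul[OF linear_rot] field_simps)
  qed
  have half: "z \<bullet> rot (2 * pi * real k / real n) u \<le> 1" if "z \<in> K" for z k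
  proof -
    have "K \<subseteq> {z. rot (2 * pi * real k / real n) u \<bullet> z \<le> 1}"
      unfolding K using vertex
      by (intro hull_minimal convex_halfspace_le) (auto simp: inner_commute)
    with that show ?thesis by (auto simp: inner_commute)
  qed
  have "compact K"
    unfolding K by (intro finite_imp_compact_convex_hull finite_orbit)
  then have "measure lebesgue K \<le> real n * tan a / (norm u)\<^sup>2"
    unfolding a_def using n v cos_a nu half
    by (intro measure_le_circumscribed) (auto simp: lmeasurable_compact fmeasurableD)
  also have "\<dots> = real n * tan a * (norm v * cos a)\<^sup>2"
    by (simp add: nu power_divide)
  finally have 1: "measure lebesgue K \<le> real n * tan a * (norm v * cos a)\<^sup>2" .
  have "orbit n v \<subseteq> K"
    by (simp add: K hull_subset)
  then have polar_half: "y \<bullet> rot (2 * pi * real k / real n) v \<le> 1" if "y \<in> polar K" "k < n" for y k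
    using that unfolding polar_def orbit_def by blast
  have "polar K \<in> sets lebesgue"
    using closed_polar[of K] borel_closed by (auto intro: sets_completionI_sets)
  then have 2: "measure lebesgue (polar K) \<le> real n * tan a / (norm v)\<^sup>2"
    unfolding a_def using n v polar_half by (intro measure_le_circumscribed) auto
  have "measure lebesgue K * measure lebesgue (polar K)
    \<le> (real n * tan a * (norm v * cos a)\<^sup>2) * (real n * tan a / (norm v)\<^sup>2)"
    using 1 2 by (intro mult_mono order_trans[OF measure_nonneg 1]) auto
  also have "\<dots> = (real n)\<^sup>2 * (sin a)\<^sup>2"
    using v cos_a by (simp add: tan_def field_simps power2_eq_square)
  finally show ?thesis by (simp add: a_def)
qed

section \<open>The volume product of bodies with rotational symmetry\<close>

theorem corollary4:
  fixes K :: "(real^2) set" and n :: nat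
  assumes "convex_body K" and "n \<ge> 3" and "rotational_symmetry n K"
  shows "measure lebesgue K * measure lebesgue (polar K) \<ge> (real n)\<^sup>2 * (sin (pi / real n))\<^sup>2
    \<and> (measure lebesgue K * measure lebesgue (polar K) = (real n)\<^sup>2 * (sin (pi / real n))\<^sup>2
        \<longleftrightarrow> regular_polygon n K)"
proof (intro conjI iffI)
  show ge: "measure lebesgue K * measure lebesgue (polar K) \<ge> (real n)\<^sup>2 * (sin (pi / real n))\<^sup>2"
    using volume_product_ge[OF assms] .
  show "regular_polygon n K"
    if "measure lebesgue K * measure lebesgue (polar K) = (real n)\<^sup>2 * (sin (pi / real n))\<^sup>2"
    using equality_imp_regular_polygon[OF assms that] .
  show "measure lebesgue K * measure lebesgue (polar K) = (real n)\<^sup>2 * (sin (pi / real n))\<^sup>2"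
    if reg: "regular_polygon n K"
  proof -
    obtain v where "v \<noteq> 0" "K = convex hull (orbit n v)"
      using regular_polygon_centred[OF assms(2) reg assms(3)] .
    then show ?thesis
      using ge regular_polygon_volume_product_le[OF assms(2)] by (meson order_antisym)
  qed
qed

end
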